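(* Let $(X,\mu)$ be an atomless probability space, let $n \geq 1$ be an integer, and let $Z = (Z_1,\ldots,Z_n)$ be an $n$-tuple of random points of $X$ (defined on a common probability space) such that for every $i \in \{1,\ldots,n\}$ the law of $Z_i$ is $\mu$. The $Z_i$ are not assumed to be independent. Then $$\sup_{\substack{f \in L^2(X,\mu) \\ \Vert f \Vert_2 = 1}} \operatorname{Var}\left(\frac{1}{n}\sum_{i=1}^n f(Z_i) - \int_X f \, d\mu\right) \geq \frac{1}{n}.$$
   Context: A probability space $(X,\mu)$ is atomless if for every measurable $B \subset X$ with $\mu(B) > 0$ there exists a measurable $C \subset B$ with $0 < \mu(C) < \mu(B)$. A random point of $X$ is an $X$-valued random variable, i.e. a measurable map from some probability space $(\Omega,\mathbb{P})$ to $X$; its law is the push-forward of $\mathbb{P}$ under this map. $L^2(X,\mu)$ is the space of square-integrable (real- or complex-valued) functions on $X$ with norm $\Vert f\Vert_2 = \left(\int_X |f|^2 \, d\mu\right)^{1/2}$. $\operatorname{Var}(Y) = \mathbb{E}\left[|Y - \mathbb{E}[Y]|^2\right]$ denotes the variance, taken with respect to $\mathbb{P}$. *)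

theory Defs
  imports "HOL-Probability.Probability"
begin

definition atomless :: "'a measure \<Rightarrow> bool" where
  "atomless M \<longleftrightarrow>
     (\<forall>B\<in>sets M. emeasure M B > 0 \<longrightarrow>
        (\<exists>C\<in>sets M. C \<subseteq> B \<and> 0 < emeasure M C \<and> emeasure M C < emeasure M B))"

text \<open>
  Square-integrable functions themselves, not classes modulo almost-everywhere equality. Both the
  norm below and the variance of a sum of \<open>f (Z i)\<close> with each \<open>Z i\<close> distributed according to
  \<open>M\<close> depend only on the class of \<open>f\<close>. The value type is polymorphic so that it can be
  instantiated to both \<^typ>\<open>real\<close> and \<^typ>\<open>complex\<close>.
\<close>

definition L2_space :: "'a measure \<Rightarrow> ('a \<Rightarrow> 'b::{banach, second_countable_topology}) set" where
  "L2_space M = {f \<in> borel_measurable M. integrable M (\<lambda>x. (norm (f x))\<^sup>2)}"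

definition L2_norm :: "'a measure \<Rightarrow> ('a \<Rightarrow> 'b::{banach, second_countable_topology}) \<Rightarrow> real" where
  "L2_norm M f = sqrt (\<integral>x. (norm (f x))\<^sup>2 \<partial>M)"

text \<open>
  The library's \<open>variance\<close> is restricted to real random variables; this version also covers
  complex ones and agrees with it on the reals.
\<close>

definition Var :: "'w measure \<Rightarrow> ('w \<Rightarrow> 'b::{banach, second_countable_topology}) \<Rightarrow> real" where
  "Var P Y = (\<integral>w. (norm (Y w - (\<integral>v. Y v \<partial>P)))\<^sup>2 \<partial>P)"

lemma (in prob_space) Var_real_eq_variance:
  fixes Y :: "'a \<Rightarrow> real"
  shows "Var M Y = variance Y"
  by (simp add: Var_def)

end

theory Submission
  imports Defs
begin

text \<open>
  The bound is approached by normalised indicators \<open>f = 1\<^sub>B / sqrt p\<close> of sets \<open>B\<close> of small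
  measure \<open>p > 0\<close>. The functions \<open>f (Z i)\<close> are nonnegative, so whatever the dependence
  between the points, the cross terms in \<open>(\<Sum>i. f (Z i))\<^sup>2\<close> can only help: the second moment of the
  average is at least \<open>(1 / n\<^sup>2) * n * E (f (Z i))\<^sup>2 = 1 / n\<close>. The mean of the average is
  \<open>p / sqrt p = sqrt p\<close>, so centring costs only \<open>p\<close>, and the variance is at least \<open>1 / n - p\<close>
  (\<open>Var_average_indicator\<close>). Nonatomicity is used once, to let \<open>p\<close> tend to \<open>0\<close>
  (\<open>atomless_small_set\<close>).

  Multiplying the indicator by a fixed unit vector \<open>e\<close> treats real and complex values at once.
\<close>

text \<open>
  A set of positive measure splits into two parts of positive measure, and one of the two has at
  most half the measure; iterate.
\<close>

lemma atomless_small_set: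
  assumes "prob_space M" and "atomless M"
  shows "\<exists>B\<in>sets M. 0 < measure M B \<and> measure M B \<le> (1 / 2) ^ k"
proof (induction k)
  interpret prob_space M by fact
  case 0
  show ?case by (intro bexI[of _ "space M"]) (auto simp: prob_space)
next
  interpret prob_space M by fact
  case (Suc k)
  then obtain B where B: "B \<in> sets M" "0 < measure M B" "measure M B \<le> (1 / 2) ^ k"
    by blast
  then obtain C where C: "C \<in> sets M" "C \<subseteq> B" "0 < measure M C" "measure M C < measure M B"
    using \<open>atomless M\<close> unfolding atomless_def
    by (force simp: emeasure_eq_measure ennreal_less_iff)
  have diff: "measure M (B - C) = measure M B - measure M C"
    using B C by (intro finite_measure_Diff) auto
  show ?case
  proof (cases "measure M C \<le> measure M B / 2")
    case True
    then show ?thesis using B C by (intro bexI[of _ C]) auto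
  next
    case False
    then show ?thesis using B C diff by (intro bexI[of _ "B - C"]) auto
  qed
qed

lemma normalized_indicator_L2:
  fixes e :: "'b::{banach, second_countable_topology}"
  assumes "prob_space M" and B: "B \<in> sets M" "0 < measure M B" and e: "norm e = 1"
  defines "f \<equiv> \<lambda>x. (indicator B x / sqrt (measure M B)) *\<^sub>R e"
  shows "f \<in> L2_space M" and "L2_norm M f = 1" and "(\<integral>x. f x \<partial>M) = sqrt (measure M B) *\<^sub>R e"
proof -
  interpret prob_space M by fact
  have sq: "(norm (f x))\<^sup>2 = indicator B x / measure M B" for x
    using B e by (auto simp: f_def power_divide indicator_def)
  have "integrable M (\<lambda>x. indicator B x / measure M B :: real)"
    using B by (intro integrable_divide integrable_real_indicator) (auto simp: emeasure_eq_measure)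
  moreover have "f \<in> borel_measurable M"
    unfolding f_def using B by measurable
  ultimately show "f \<in> L2_space M"
    by (simp add: L2_space_def sq)
  show "L2_norm M f = 1"
    unfolding L2_norm_def using B by (simp add: sq)
  have "(\<integral>x. f x \<partial>M) = (measure M B / sqrt (measure M B)) *\<^sub>R e"
    unfolding f_def using B
    by (subst integral_scaleR_left)
      (auto intro!: integrable_divide integrable_real_indicator simp: emeasure_eq_measure)
  then show "(\<integral>x. f x \<partial>M) = sqrt (measure M B) *\<^sub>R e"
    by (simp add: real_div_sqrt)
qed

lemma Var_average_indicator:
  fixes e :: "'b::{banach, second_countable_topology}"
  assumes "prob_space M" and "prob_space P" and n: "n \<ge> 1"
    and Z: "\<And>i. i \<in> {1..n} \<Longrightarrow> Z i \<in> measurable P M"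
    and law: "\<And>i. i \<in> {1..n} \<Longrightarrow> distr P M (Z i) = M"
    and B: "B \<in> sets M" "0 < measure M B" and e: "norm e = 1"
  defines "f \<equiv> \<lambda>x. (indicator B x / sqrt (measure M B)) *\<^sub>R e"
  shows "1 / real n - measure M B
    \<le> Var P (\<lambda>w. (1 / real n) *\<^sub>R (\<Sum>i=1..n. f (Z i w)) - (\<integral>x. f x \<partial>M))"
proof -
  interpret P: prob_space P by fact
  define p where "p = measure M B"
  have p: "p > 0" using B by (simp add: p_def)
  define g where "g i w = indicator B (Z i w) / sqrt p" for i w
  define S where "S w = (1 / real n) * (\<Sum>i=1..n. g i w)" for w
  have g_meas [measurable]: "g i \<in> borel_measurable P" if "i \<in> {1..n}" for i
    using Z[OF that] B unfolding g_def by measurable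
  have g_bounds: "0 \<le> g i w" "g i w \<le> 1 / sqrt p" for i w
    using p by (auto simp: g_def indicator_def)
  have g_int: "integrable P (g i)" if "i \<in> {1..n}" for i
    by (rule P.integrable_const_bound[where B = "1 / sqrt p"])
      (use g_bounds g_meas that in auto)
  have prob_g: "(\<integral>w. indicator B (Z i w) \<partial>P) = p" if "i \<in> {1..n}" for i
  proof -
    have "(\<integral>w. indicator B (Z i w) \<partial>P) = (\<integral>x. indicator B x \<partial>distr P M (Z i) :: real)"
      using Z[OF that] B by (subst integral_distr) auto
    then show ?thesis using law[OF that] B by (simp add: p_def)
  qed
  have g_mean: "(\<integral>w. g i w \<partial>P) = sqrt p" if "i \<in> {1..n}" for i
    unfolding g_def using prob_g[OF that] by (simp add: real_div_sqrt p less_imp_le)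
  have g_sq: "(g i w)\<^sup>2 = g i w / sqrt p" for i w
    by (auto simp: g_def indicator_def power2_eq_square)
  have S_meas [measurable]: "S \<in> borel_measurable P"
    unfolding S_def by measurable
  have S_int: "integrable P S"
    unfolding S_def by (intro integrable_mult_right Bochner_Integration.integrable_sum g_int) auto
  have S_mean: "(\<integral>w. S w \<partial>P) = sqrt p"
    unfolding S_def using n
    by (simp add: Bochner_Integration.integral_sum g_int g_mean)
  have S_bounds: "0 \<le> S w" "S w \<le> 1 / sqrt p" for w
  proof -
    show "0 \<le> S w" unfolding S_def by (intro mult_nonneg_nonneg sum_nonneg g_bounds) auto
    have "(\<Sum>i=1..n. g i w) \<le> real n * (1 / sqrt p)"
      using sum_bounded_above[of "{1..n}" "\<lambda>i. g i w" "1 / sqrt p"] g_bounds by simp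
    then show "S w \<le> 1 / sqrt p" unfolding S_def using n by (simp add: field_simps)
  qed
  have S2_int: "integrable P (\<lambda>w. (S w)\<^sup>2)"
    by (rule P.integrable_const_bound[where B = "(1 / sqrt p)\<^sup>2"])
      (use S_bounds in \<open>auto intro!: power_mono simp del: power_divide\<close>)
  have S_sq: "(1 / (real n)\<^sup>2) * (\<Sum>i=1..n. g i w / sqrt p) \<le> (S w)\<^sup>2" for w
  proof -
    \<comment> \<open>Nonnegativity replaces independence: the cross terms are dropped pointwise.\<close>
    have "(\<Sum>i=1..n. (g i w)\<^sup>2) \<le> (\<Sum>i=1..n. g i w * (\<Sum>j=1..n. g j w))"
      unfolding power2_eq_square
      by (intro sum_mono mult_left_mono member_le_sum g_bounds) auto
    also have "\<dots> = (\<Sum>i=1..n. g i w)\<^sup>2"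
      by (simp add: power2_eq_square sum_distrib_right)
    finally show ?thesis
      unfolding S_def g_sq power_mult_distrib power_divide power_one
      by (intro mult_left_mono) auto
  qed
  have "1 / real n = (\<integral>w. (1 / (real n)\<^sup>2) * (\<Sum>i=1..n. g i w / sqrt p) \<partial>P)"
    using n p by (simp add: Bochner_Integration.integral_sum g_int g_mean power2_eq_square)
  also have "\<dots> \<le> (\<integral>w. (S w)\<^sup>2 \<partial>P)"
    by (intro integral_mono S2_int S_sq integrable_mult_right Bochner_Integration.integrable_sum
        integrable_divide g_int) auto
  finally have second_moment: "1 / real n \<le> (\<integral>w. (S w)\<^sup>2 \<partial>P)" .
  have Y: "(1 / real n) *\<^sub>R (\<Sum>i=1..n. f (Z i w)) - (\<integral>x. f x \<partial>M) = (S w - sqrt p) *\<^sub>R e" for w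
    using normalized_indicator_L2(3)[OF \<open>prob_space M\<close> B e]
    by (simp add: f_def S_def g_def p_def scaleR_diff_left flip: scaleR_sum_left)
  have "(\<integral>w. S w - sqrt p \<partial>P) = 0"
    using S_int S_mean by (simp add: P.prob_space)
  then have "(\<integral>w. (S w - sqrt p) *\<^sub>R e \<partial>P) = 0"
    using S_int by simp
  then have "Var P (\<lambda>w. (S w - sqrt p) *\<^sub>R e) = P.variance S"
    unfolding Var_def using e S_mean by simp
  also have "\<dots> = (\<integral>w. (S w)\<^sup>2 \<partial>P) - p"
    using P.variance_eq[OF S_int S2_int] S_mean p by simp
  finally show ?thesis
    using second_moment unfolding Y p_def by simp
qed

lemma SUP_Var_ge:
  fixes e :: "'b::{banach, second_countable_topology}"
  assumes "prob_space M" and "atomless M" and "prob_space P" and "n \<ge> 1"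
    and "\<And>i. i \<in> {1..n} \<Longrightarrow> Z i \<in> measurable P M"
    and "\<And>i. i \<in> {1..n} \<Longrightarrow> distr P M (Z i) = M"
    and e: "norm e = 1"
  shows "ereal (1 / real n) \<le> (SUP f \<in> {f :: 'a \<Rightarrow> 'b. f \<in> L2_space M \<and> L2_norm M f = 1}.
    ereal (Var P (\<lambda>w. (1 / real n) *\<^sub>R (\<Sum>i=1..n. f (Z i w)) - (\<integral>x. f x \<partial>M))))"
    (is "_ \<le> ?S")
proof (rule LIMSEQ_le_const2)
  have "(\<lambda>k. 1 / real n - (1 / 2) ^ k) \<longlonglongrightarrow> 1 / real n - 0"
    by (intro tendsto_diff tendsto_const LIMSEQ_power_zero) simp
  then show "(\<lambda>k. ereal (1 / real n - (1 / 2) ^ k)) \<longlonglongrightarrow> ereal (1 / real n)"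
    by simp
  have "ereal (1 / real n - (1 / 2) ^ k) \<le> ?S" for k
  proof -
    obtain B where B: "B \<in> sets M" "0 < measure M B" "measure M B \<le> (1 / 2) ^ k"
      using atomless_small_set[OF assms(1,2)] by blast
    define f where "f = (\<lambda>x. (indicator B x / sqrt (measure M B)) *\<^sub>R e)"
    have "1 / real n - (1 / 2) ^ k \<le> 1 / real n - measure M B"
      using B(3) by simp
    also have "\<dots> \<le> Var P (\<lambda>w. (1 / real n) *\<^sub>R (\<Sum>i=1..n. f (Z i w)) - (\<integral>x. f x \<partial>M))"
      unfolding f_def by (rule Var_average_indicator) (use assms B in auto)
    finally have "ereal (1 / real n - (1 / 2) ^ k)
        \<le> ereal (Var P (\<lambda>w. (1 / real n) *\<^sub>R (\<Sum>i=1..n. f (Z i w)) - (\<integral>x. f x \<partial>M)))"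
      by simp
    moreover have "f \<in> L2_space M" "L2_norm M f = 1"
      using normalized_indicator_L2[OF assms(1) B(1,2) e] unfolding f_def by blast+
    ultimately show ?thesis
      by (intro SUP_upper2[of f]) auto
  qed
  then show "\<exists>N. \<forall>k\<ge>N. ereal (1 / real n - (1 / 2) ^ k) \<le> ?S"
    by blast
qed

theorem mainTheorem2:
  fixes M :: "'a measure" and P :: "'w measure" and Z :: "nat \<Rightarrow> 'w \<Rightarrow> 'a" and n :: nat
  assumes "prob_space M" and "atomless M"
    and "prob_space P"
    and "n \<ge> 1"
    and "\<And>i. i \<in> {1..n} \<Longrightarrow> Z i \<in> measurable P M"
    and "\<And>i. i \<in> {1..n} \<Longrightarrow> distr P M (Z i) = M"
  shows "(SUP f \<in> {f :: 'a \<Rightarrow> real. f \<in> L2_space M \<and> L2_norm M f = 1}.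
            ereal (Var P (\<lambda>w. (1 / real n) *\<^sub>R (\<Sum>i=1..n. f (Z i w)) - (\<integral>x. f x \<partial>M))))
           \<ge> ereal (1 / real n)
       \<and> (SUP f \<in> {f :: 'a \<Rightarrow> complex. f \<in> L2_space M \<and> L2_norm M f = 1}.
            ereal (Var P (\<lambda>w. (1 / real n) *\<^sub>R (\<Sum>i=1..n. f (Z i w)) - (\<integral>x. f x \<partial>M))))
           \<ge> ereal (1 / real n)"
  by (intro conjI SUP_Var_ge[where e = "1 :: real"] SUP_Var_ge[where e = "1 :: complex"])
    (use assms in auto)

end
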